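(* Let $F:\mathbb{R}^d\to\mathbb{R}^d$, fix $A\in(0,1]$, let $x_k\in\mathbb{R}^d$ with $F(x_k)\neq 0$, and let $\hat x_k=x_k-\gamma_kF(x_k)$ with $\gamma_k>0$. Then the critical condition $$\|F(\hat x_k)-F(x_k)\|\le A\|F(x_k)\|$$ is satisfied in each of the following cases: 1. $F$ is $L$-Lipschitz with constant $L>0$, and $0<\gamma_k\le\frac{A}{L}$. 2. $F$ is $(L,\nu)$-Hölder with $L>0$, $\nu\in(0,1]$, and $0<\gamma_k\le\left(\frac{A}{L}\right)^{1/\nu}\|F(x_k)\|^{\frac{1-\nu}{\nu}}$. 3. $F$ is $(L_0,L_1)$-Lipschitz, and $0<\gamma_k\le\frac{\nu_A}{L_0+L_1\|F(x_k)\|}$, where $\nu_A>0$ satisfies $\nu_Ae^{\nu_A}\le A$. 4. $F$ is $L$-Lipschitz, $(L,\nu)$-Hölder or $(L_0,L_1)$-Lipschitz, and $x_k$ is an iterate and $\gamma_k$ is the step-size returned by the line-search rule of the algorithm PolyakEG-LS (run with this $A$) at iteration $k$.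
   Context: $\|\cdot\|$ is the Euclidean norm. $F$ is $L$-Lipschitz if $\|F(x)-F(y)\|\le L\|x-y\|$ for all $x,y\in\mathbb{R}^d$. For $0<\nu\le 1$, $F$ is $(L,\nu)$-Hölder if $\|F(x)-F(y)\|\le L\|x-y\|^{\nu}$ for all $x,y$. For constants $L_0,L_1\ge 0$ (not both zero), $F$ is $(L_0,L_1)$-Lipschitz if for all $x,y$, $$\|F(x)-F(y)\|\le\left(L_0+L_1\max_{\theta\in[0,1]}\|F(\theta x+(1-\theta)y)\|\right)\|x-y\|.$$ PolyakEG-LS. Inputs: $x_0\in\mathbb{R}^d$, $\lambda_{-1}^0>0$, $\lambda_{-1}^1\ge 0$, $\beta>2$, $0<A\le 1$, and $\nu_A>0$ with $\nu_Ae^{\nu_A}\le A$. Set $\mathrm{toggle}=0$. For $k=0,1,2,\dots$: (i) if $F(x_k)=0$, return $x_k$; (ii) set $\lambda_k^0=\lambda_{k-1}^0$, $\lambda_k^1=\lambda_{k-1}^1$, $\gamma_k=\frac{\nu_A}{\lambda_k^0+\lambda_k^1\|F(x_k)\|}$, $\hat x_k=x_k-\gamma_kF(x_k)$; (iii) while $\|F(x_k)-F(\hat x_k)\|>A\|F(x_k)\|$: if $\mathrm{toggle}=0$, replace $\lambda_k^0$ by $\lambda_k^0\left(\beta-\frac{\lambda_k^0}{\lambda_k^0+\lambda_k^1\|F(x_k)\|}\right)$ and set $\mathrm{toggle}=1$; else (if $\mathrm{toggle}=1$) replace $\lambda_k^1$ by $\lambda_k^1\left(\beta-\frac{\lambda_k^1\|F(x_k)\|}{\lambda_k^0+\lambda_k^1\|F(x_k)\|}\right)$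 and set $\mathrm{toggle}=0$; in either case then recompute $\gamma_k=\frac{\nu_A}{\lambda_k^0+\lambda_k^1\|F(x_k)\|}$ and $\hat x_k=x_k-\gamma_kF(x_k)$; (iv) set $\alpha_k=\frac{\langle F(\hat x_k),x_k-\hat x_k\rangle}{\|F(\hat x_k)\|^2}$ and $x_{k+1}=x_k-\alpha_kF(\hat x_k)$. The step-size returned by the line-search at iteration $k$ is the value of $\gamma_k$ when the while loop (iii) exits. *)

theory Defs
  imports "HOL-Analysis.Analysis" "HOL-Library.While_Combinator"
begin

definition holder_continuous :: "real \<Rightarrow> real \<Rightarrow> (real ^ 'd \<Rightarrow> real ^ 'd) \<Rightarrow> bool" where
  "holder_continuous L \<nu> F \<longleftrightarrow> (\<forall>x y. norm (F x - F y) \<le> L * norm (x - y) powr \<nu>)"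

text \<open>
  The maximum of the norm of \<open>F\<close> over the segment ranges over an infinite set of reals. It is
  expressed by a maximizing parameter \<open>t\<close>, so that the definition demands that the maximum
  exists (a supremum in the type \<^typ>\<open>real\<close> would be unspecified for unbounded sets).
\<close>
definition L0_L1_lipschitz :: "real \<Rightarrow> real \<Rightarrow> (real ^ 'd \<Rightarrow> real ^ 'd) \<Rightarrow> bool" where
  "L0_L1_lipschitz L0 L1 F \<longleftrightarrow>
     0 \<le> L0 \<and> 0 \<le> L1 \<and> \<not> (L0 = 0 \<and> L1 = 0) \<and>
     (\<forall>x y. \<exists>t. is_arg_max (\<lambda>\<theta>. norm (F (\<theta> *\<^sub>R x + (1 - \<theta>) *\<^sub>R y))) (\<lambda>\<theta>. \<theta> \<in> {0..1}) t \<and>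
        norm (F x - F y) \<le> (L0 + L1 * norm (F (t *\<^sub>R x + (1 - t) *\<^sub>R y))) * norm (x - y))"

definition critical_condition ::
    "(real ^ 'd \<Rightarrow> real ^ 'd) \<Rightarrow> real \<Rightarrow> real ^ 'd \<Rightarrow> real ^ 'd \<Rightarrow> bool" where
  "critical_condition F A x xhat \<longleftrightarrow> norm (F xhat - F x) \<le> A * norm (F x)"


text \<open>
  The algorithm PolyakEG-LS. The persistent variables of the line-search are
  \<open>(\<lambda>\<^sup>0, \<lambda>\<^sup>1, toggle)\<close>. The step-size and the extrapolated point are recomputed after each change of
  these variables, hence they are functions of them. The argument \<open>g\<close> stands for the norm of
  \<open>F\<close> at the current iterate.
\<close>
type_synonym ls_state = "real \<times> real \<times> nat"

fun ls_gamma :: "real \<Rightarrow> real \<Rightarrow> ls_state \<Rightarrow> real" where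
  "ls_gamma \<nu>A g (l0, l1, toggle) = \<nu>A / (l0 + l1 * g)"

fun ls_update :: "real \<Rightarrow> real \<Rightarrow> ls_state \<Rightarrow> ls_state" where
  "ls_update \<beta> g (l0, l1, toggle) =
     (if toggle = 0
      then (l0 * (\<beta> - l0 / (l0 + l1 * g)), l1, 1)
      else (l0, l1 * (\<beta> - l1 * g / (l0 + l1 * g)), 0))"

definition ls_xhat ::
    "(real ^ 'd \<Rightarrow> real ^ 'd) \<Rightarrow> real \<Rightarrow> real ^ 'd \<Rightarrow> ls_state \<Rightarrow> real ^ 'd" where
  "ls_xhat F \<nu>A x s = x - ls_gamma \<nu>A (norm (F x)) s *\<^sub>R F x"

text \<open>The result is \<^term>\<open>None\<close> iff the while loop does not terminate.\<close>
definition line_search ::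
    "(real ^ 'd \<Rightarrow> real ^ 'd) \<Rightarrow> real \<Rightarrow> real \<Rightarrow> real \<Rightarrow> real ^ 'd \<Rightarrow> ls_state \<Rightarrow> ls_state option" where
  "line_search F A \<nu>A \<beta> x s =
     while_option (\<lambda>s. norm (F x - F (ls_xhat F \<nu>A x s)) > A * norm (F x))
       (ls_update \<beta> (norm (F x))) s"

text \<open>
  The \<open>k\<close>-th iterate together with the line-search variables at the start of iteration \<open>k\<close>;
  \<^term>\<open>None\<close> if iteration \<open>k\<close> is not reached, i.e. if the algorithm has returned or some
  line-search has not terminated before. If \<open>F\<close> vanishes at the extrapolated point (possible
  only for \<open>A = 1\<close>), the quotient \<open>\<alpha>\<close> is 0 / 0, but then the next iterate equals the current
  one whatever the value of \<open>\<alpha>\<close>.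
\<close>
primrec polyak_eg_ls ::
    "(real ^ 'd \<Rightarrow> real ^ 'd) \<Rightarrow> real \<Rightarrow> real \<Rightarrow> real \<Rightarrow> real ^ 'd \<Rightarrow> real \<Rightarrow> real \<Rightarrow> nat
      \<Rightarrow> ((real ^ 'd) \<times> ls_state) option" where
  "polyak_eg_ls F A \<nu>A \<beta> x0 l0 l1 0 = Some (x0, (l0, l1, 0))"
| "polyak_eg_ls F A \<nu>A \<beta> x0 l0 l1 (Suc k) =
     (case polyak_eg_ls F A \<nu>A \<beta> x0 l0 l1 k of
        None \<Rightarrow> None
      | Some (x, s) \<Rightarrow>
          if F x = 0 then None
          else (case line_search F A \<nu>A \<beta> x s of
                  None \<Rightarrow> None
                | Some s' \<Rightarrow>
                    (let xhat = ls_xhat F \<nu>A x s';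
                         \<alpha> = (F xhat \<bullet> (x - xhat)) / (norm (F xhat))\<^sup>2
                     in Some (x - \<alpha> *\<^sub>R F xhat, s'))))"

definition polyak_eg_ls_iterate ::
    "(real ^ 'd \<Rightarrow> real ^ 'd) \<Rightarrow> real \<Rightarrow> real \<Rightarrow> real \<Rightarrow> real ^ 'd \<Rightarrow> real \<Rightarrow> real \<Rightarrow> nat
      \<Rightarrow> (real ^ 'd) option" where
  "polyak_eg_ls_iterate F A \<nu>A \<beta> x0 l0 l1 k = map_option fst (polyak_eg_ls F A \<nu>A \<beta> x0 l0 l1 k)"

definition polyak_eg_ls_stepsize ::
    "(real ^ 'd \<Rightarrow> real ^ 'd) \<Rightarrow> real \<Rightarrow> real \<Rightarrow> real \<Rightarrow> real ^ 'd \<Rightarrow> real \<Rightarrow> real \<Rightarrow> nat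
      \<Rightarrow> real option" where
  "polyak_eg_ls_stepsize F A \<nu>A \<beta> x0 l0 l1 k =
     (case polyak_eg_ls F A \<nu>A \<beta> x0 l0 l1 k of
        None \<Rightarrow> None
      | Some (x, s) \<Rightarrow>
          if F x = 0 then None
          else map_option (ls_gamma \<nu>A (norm (F x))) (line_search F A \<nu>A \<beta> x s))"

end

theory Submission
  imports Defs
begin

text \<open>
  Along the segment from \<open>x\<close> to \<open>x - \<gamma> F(x)\<close>, which has length \<open>\<gamma> \<parallel>F(x)\<parallel>\<close>, a Lipschitz or Hoelder
  bound on the variation of \<open>F\<close> becomes the critical condition as soon as \<open>\<gamma>\<close> is below the stated
  threshold; both are direct computations.

  For \<open>(L\<^sub>0, L\<^sub>1)\<close>-Lipschitz maps the bound involves the maximum of \<open>\<parallel>F\<parallel>\<close> over the segment, which has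
  to be controlled by the value \<open>\<parallel>F(x)\<parallel>\<close> at its start. The estimate needed is
  \<open>\<parallel>F(y) - F(x)\<parallel> \<le> (L\<^sub>0 + L\<^sub>1 \<parallel>F(x)\<parallel>) exp (L\<^sub>1 \<parallel>x - y\<parallel>) \<parallel>x - y\<parallel>\<close>, a Gronwall inequality. It is obtained
  here by a discrete argument. On a segment with \<open>L\<^sub>1 \<parallel>x - y\<parallel> < 1\<close> the inequality at the maximizer
  can be solved for the maximum, which gives the factor \<open>1 / (1 - L\<^sub>1 \<parallel>x - y\<parallel>)\<close> in place of the
  exponential. Cutting the segment into \<open>n\<close> equal pieces multiplies \<open>n\<close> such factors, and
  \<open>(1 - c / n)\<^sup>n\<close> tends to \<open>exp (- c)\<close>.

  For the line-search, a step-size that it returns satisfies the critical condition because this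
  is the exit condition of the loop. It does return a step-size: the updates alternate between the
  two parameters, so that every two of them multiply \<open>\<lambda>\<^sup>0\<close> by at least \<open>\<beta> - 1 > 1\<close>. The trial
  step-sizes therefore tend to 0, and the first three cases provide, for each of the classes of
  maps, a positive threshold below which the exit condition holds.
\<close>

section \<open>Lipschitz and Hoelder continuous maps\<close>

lemma critical_condition_lipschitz:
  assumes "0 < L" "L-lipschitz_on UNIV F" "0 \<le> \<gamma>" "\<gamma> \<le> A / L"
  shows "critical_condition F A x (x - \<gamma> *\<^sub>R F x)"
proof -
  have "norm (F (x - \<gamma> *\<^sub>R F x) - F x) \<le> L * (\<gamma> * norm (F x))"
    using lipschitz_onD[OF assms(2), of "x - \<gamma> *\<^sub>R F x" x] \<open>0 \<le> \<gamma>\<close> by (simp add: dist_norm)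
  also have "\<dots> = (L * \<gamma>) * norm (F x)"
    by simp
  also have "\<dots> \<le> A * norm (F x)"
    using assms by (intro mult_right_mono) (simp_all add: field_simps)
  finally show ?thesis
    by (simp add: critical_condition_def)
qed

lemma critical_condition_holder:
  assumes "0 < A" "0 < L" "0 < \<nu>" "holder_continuous L \<nu> F" "F x \<noteq> 0" "0 \<le> \<gamma>"
    and \<gamma>: "\<gamma> \<le> (A / L) powr (1 / \<nu>) * norm (F x) powr ((1 - \<nu>) / \<nu>)"
  shows "critical_condition F A x (x - \<gamma> *\<^sub>R F x)"
proof -
  let ?g = "norm (F x)"
  have "0 < ?g"
    using assms by simp
  have "\<gamma> powr \<nu> \<le> ((A / L) powr (1 / \<nu>) * ?g powr ((1 - \<nu>) / \<nu>)) powr \<nu>"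
    using assms by (intro powr_mono2) auto
  also have "\<dots> = A / L * ?g powr (1 - \<nu>)"
    using assms by (simp add: powr_mult powr_powr)
  finally have step: "\<gamma> powr \<nu> \<le> A / L * ?g powr (1 - \<nu>)" .
  have "norm (F (x - \<gamma> *\<^sub>R F x) - F x) \<le> L * norm ((x - \<gamma> *\<^sub>R F x) - x) powr \<nu>"
    using assms(4) unfolding holder_continuous_def by blast
  also have "\<dots> = L * (\<gamma> powr \<nu> * ?g powr \<nu>)"
    using \<open>0 \<le> \<gamma>\<close> by (simp add: powr_mult)
  also have "\<dots> \<le> L * (A / L * ?g powr (1 - \<nu>) * ?g powr \<nu>)"
    using step \<open>0 < L\<close> by (intro mult_left_mono mult_right_mono) auto
  also have "\<dots> = A * (?g powr (1 - \<nu>) * ?g powr \<nu>)"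
    using \<open>0 < L\<close> by simp
  also have "\<dots> = A * ?g"
    using \<open>0 < ?g\<close> by (simp flip: powr_add)
  finally show ?thesis
    by (simp add: critical_condition_def)
qed

section \<open>Maps whose Lipschitz constant depends on their size\<close>

text \<open>
  The maximizer \<open>w\<close> lies on the segment, and the segment from \<open>x\<close> to \<open>w\<close> has no larger maximum.
  Hence \<open>q = L\<^sub>0 + L\<^sub>1 \<parallel>F(w)\<parallel>\<close> satisfies \<open>q \<le> L\<^sub>0 + L\<^sub>1 \<parallel>F(x)\<parallel> + L\<^sub>1 q \<parallel>x - y\<parallel>\<close>, which can be solved for
  \<open>q\<close> on a short segment.
\<close>
lemma L0_L1_lipschitz_short_segment:
  assumes F: "L0_L1_lipschitz L0 L1 F" and short: "L1 * norm (x - y) < 1"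
  shows "norm (F y - F x) \<le> (L0 + L1 * norm (F x)) / (1 - L1 * norm (x - y)) * norm (x - y)"
proof -
  have L: "0 \<le> L0" "0 \<le> L1"
    and FD: "\<And>x y. \<exists>t. is_arg_max (\<lambda>\<theta>. norm (F (\<theta> *\<^sub>R x + (1 - \<theta>) *\<^sub>R y))) (\<lambda>\<theta>. \<theta> \<in> {0..1}) t \<and>
        norm (F x - F y) \<le> (L0 + L1 * norm (F (t *\<^sub>R x + (1 - t) *\<^sub>R y))) * norm (x - y)"
    using F unfolding L0_L1_lipschitz_def by blast+
  from FD[of x y] obtain t where t: "0 \<le> t" "t \<le> 1"
    and max: "\<And>\<theta>. 0 \<le> \<theta> \<Longrightarrow> \<theta> \<le> 1 \<Longrightarrow>
      norm (F (\<theta> *\<^sub>R x + (1 - \<theta>) *\<^sub>R y)) \<le> norm (F (t *\<^sub>R x + (1 - t) *\<^sub>R y))"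
    and bound: "norm (F x - F y) \<le> (L0 + L1 * norm (F (t *\<^sub>R x + (1 - t) *\<^sub>R y))) * norm (x - y)"
    by (auto simp: is_arg_max_linorder)
  define w where "w = t *\<^sub>R x + (1 - t) *\<^sub>R y"
  define q where "q = L0 + L1 * norm (F w)"
  have "0 \<le> q"
    using L by (simp add: q_def)
  from FD[of x w] obtain s where s: "0 \<le> s" "s \<le> 1"
    and bound_w: "norm (F x - F w) \<le> (L0 + L1 * norm (F (s *\<^sub>R x + (1 - s) *\<^sub>R w))) * norm (x - w)"
    by (auto simp: is_arg_max_linorder)
  have "s *\<^sub>R x + (1 - s) *\<^sub>R w = (s + (1 - s) * t) *\<^sub>R x + (1 - (s + (1 - s) * t)) *\<^sub>R y"
    by (simp add: w_def algebra_simps)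
  moreover have "s + (1 - s) * t \<le> 1"
    using mult_left_mono[of t 1 "1 - s"] s t by simp
  ultimately have "norm (F (s *\<^sub>R x + (1 - s) *\<^sub>R w)) \<le> norm (F w)"
    using max[of "s + (1 - s) * t"] s t by (simp add: w_def)
  then have max_w: "L0 + L1 * norm (F (s *\<^sub>R x + (1 - s) *\<^sub>R w)) \<le> q"
    using L by (simp add: q_def mult_left_mono)
  have "x - w = (1 - t) *\<^sub>R (x - y)"
    by (simp add: w_def algebra_simps)
  then have "norm (x - w) \<le> norm (x - y)"
    using t by (simp add: mult_left_le_one_le)
  then have "norm (F x - F w) \<le> q * norm (x - y)"
    using bound_w mult_mono[OF max_w _ \<open>0 \<le> q\<close>] by fastforce
  then have "norm (F w) \<le> norm (F x) + q * norm (x - y)"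
    using norm_triangle_sub[of "F w" "F x"] by (simp add: norm_minus_commute)
  then have "L1 * norm (F w) \<le> L1 * (norm (F x) + q * norm (x - y))"
    using L by (intro mult_left_mono)
  then have "q * (1 - L1 * norm (x - y)) \<le> L0 + L1 * norm (F x)"
    by (simp add: q_def algebra_simps)
  then have "q \<le> (L0 + L1 * norm (F x)) / (1 - L1 * norm (x - y))"
    using short by (simp add: pos_le_divide_eq)
  moreover have "norm (F y - F x) \<le> q * norm (x - y)"
    using bound by (simp add: w_def q_def norm_minus_commute)
  ultimately show ?thesis
    by (meson mult_right_mono norm_ge_zero order_trans)
qed

text \<open>
  The short-segment bound is applied to each of \<open>n\<close> equal pieces. The quantity \<open>L\<^sub>0 + L\<^sub>1 \<parallel>F\<parallel>\<close> grows
  by at most the factor \<open>\<kappa> = 1 / (1 - L\<^sub>1 \<parallel>x - y\<parallel> / n)\<close> from one subdivision point to the next, so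
  that each piece contributes at most \<open>(L\<^sub>0 + L\<^sub>1 \<parallel>F(x)\<parallel>) \<kappa>\<^sup>n \<parallel>x - y\<parallel> / n\<close> to the variation.
  The factor \<open>\<kappa>\<^sup>n\<close> is moved to the left-hand side, where the limit in \<open>n\<close> is that of \<open>(1 - c / n)\<^sup>n\<close>.
\<close>
lemma L0_L1_lipschitz_subdivision:
  assumes F: "L0_L1_lipschitz L0 L1 F" and n: "L1 * norm (x - y) < real n"
  shows "norm (F y - F x) * (1 - L1 * norm (x - y) / real n) ^ n
           \<le> (L0 + L1 * norm (F x)) * norm (x - y)"
proof -
  have L: "0 \<le> L0" "0 \<le> L1"
    using F by (auto simp: L0_L1_lipschitz_def)
  have "0 < real n"
    using n L by (meson le_less_trans mult_nonneg_nonneg norm_ge_zero)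
  define p where "p i = x + (real i / real n) *\<^sub>R (y - x)" for i
  define \<delta> where "\<delta> = norm (x - y) / real n"
  define \<kappa> where "\<kappa> = 1 / (1 - L1 * \<delta>)"
  define a where "a = L0 + L1 * norm (F x)"
  have \<delta>: "0 \<le> \<delta>" "L1 * \<delta> < 1"
    using n \<open>0 < real n\<close> by (simp_all add: \<delta>_def)
  have "0 \<le> L1 * \<delta>"
    using L \<delta> by simp
  then have \<kappa>: "1 \<le> \<kappa>" "\<kappa> = 1 + \<kappa> * (L1 * \<delta>)"
    using \<delta> by (simp_all add: \<kappa>_def field_simps)
  have "0 \<le> a"
    using L by (simp add: a_def)
  have dist_p: "norm (p i - p (Suc i)) = \<delta>" for i
  proof -
    have "p i - p (Suc i) = (1 / real n) *\<^sub>R (x - y)"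
      using \<open>0 < real n\<close> by (simp add: p_def add_divide_distrib algebra_simps)
    then show ?thesis
      by (simp add: \<delta>_def)
  qed
  have piece: "norm (F (p (Suc i)) - F (p i)) \<le> (L0 + L1 * norm (F (p i))) * \<kappa> * \<delta>" for i
    using L0_L1_lipschitz_short_segment[OF F, of "p i" "p (Suc i)"] \<delta>
    by (simp add: dist_p \<kappa>_def)
  have growth: "L0 + L1 * norm (F (p i)) \<le> a * \<kappa> ^ i" for i
  proof (induction i)
    case 0
    show ?case
      by (simp add: p_def a_def)
  next
    case (Suc i)
    let ?b = "L0 + L1 * norm (F (p i))"
    have "norm (F (p (Suc i))) \<le> norm (F (p i)) + ?b * \<kappa> * \<delta>"
      using norm_triangle_sub[of "F (p (Suc i))" "F (p i)"] piece[of i] by simp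
    then have "L1 * norm (F (p (Suc i))) \<le> L1 * (norm (F (p i)) + ?b * \<kappa> * \<delta>)"
      using L by (intro mult_left_mono)
    then have "L0 + L1 * norm (F (p (Suc i))) \<le> ?b * (1 + \<kappa> * (L1 * \<delta>))"
      by (simp add: algebra_simps)
    also have "\<dots> = ?b * \<kappa>"
      using \<kappa>(2) by simp
    also have "\<dots> \<le> a * \<kappa> ^ i * \<kappa>"
      using Suc \<kappa> by (intro mult_right_mono) auto
    finally show ?case
      by (simp add: mult_ac)
  qed
  have "norm (F (p i) - F x) \<le> real i * (a * \<kappa> ^ n * \<delta>)" if "i \<le> n" for i
    using that
  proof (induction i)
    case 0
    show ?case
      by (simp add: p_def)
  next
    case (Suc i)
    have "norm (F (p (Suc i)) - F (p i)) \<le> a * \<kappa> ^ i * \<kappa> * \<delta>"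
      using piece[of i] growth[of i] \<kappa> \<delta>
      by (meson mult_right_mono order_trans zero_le_one)
    also have "\<dots> = a * \<kappa> ^ Suc i * \<delta>"
      by simp
    also have "\<dots> \<le> a * \<kappa> ^ n * \<delta>"
      by (intro mult_right_mono mult_left_mono power_increasing Suc.prems \<kappa>(1) \<delta>(1) \<open>0 \<le> a\<close>)
    finally have "norm (F (p (Suc i)) - F (p i)) \<le> a * \<kappa> ^ n * \<delta>" .
    moreover have "norm (F (p (Suc i)) - F x)
        \<le> norm (F (p (Suc i)) - F (p i)) + norm (F (p i) - F x)"
      using norm_triangle_ineq[of "F (p (Suc i)) - F (p i)" "F (p i) - F x"] by simp
    ultimately show ?case
      using Suc by (simp add: algebra_simps)
  qed
  from this[of n] have "norm (F y - F x) \<le> a * norm (x - y) * \<kappa> ^ n"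
    using \<open>0 < real n\<close> by (simp add: p_def \<delta>_def mult_ac)
  moreover have "\<kappa> ^ n = 1 / (1 - L1 * norm (x - y) / real n) ^ n"
    by (simp add: \<kappa>_def \<delta>_def power_one_over)
  moreover have "0 < (1 - L1 * norm (x - y) / real n) ^ n"
    using n \<open>0 < real n\<close> by simp
  ultimately show ?thesis
    by (simp add: a_def pos_le_divide_eq)
qed

theorem L0_L1_lipschitz_exp_bound:
  assumes F: "L0_L1_lipschitz L0 L1 F"
  shows "norm (F y - F x) \<le> (L0 + L1 * norm (F x)) * exp (L1 * norm (x - y)) * norm (x - y)"
proof -
  let ?c = "L1 * norm (x - y)"
  have "(\<lambda>n. (1 + (- ?c) / real n) ^ n) \<longlonglongrightarrow> exp (- ?c)"
    by (rule tendsto_exp_limit_sequentially)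
  then have "(\<lambda>n. norm (F y - F x) * (1 - ?c / real n) ^ n) \<longlonglongrightarrow> norm (F y - F x) * exp (- ?c)"
    by (intro tendsto_intros) simp
  moreover have "\<forall>\<^sub>F n in sequentially.
      norm (F y - F x) * (1 - ?c / real n) ^ n \<le> (L0 + L1 * norm (F x)) * norm (x - y)"
    using eventually_compose_filterlim[OF eventually_gt_at_top filterlim_real_sequentially, of ?c]
    by eventually_elim (rule L0_L1_lipschitz_subdivision[OF F])
  ultimately have "norm (F y - F x) * exp (- ?c) \<le> (L0 + L1 * norm (F x)) * norm (x - y)"
    using tendsto_upperbound by fastforce
  then have "norm (F y - F x) \<le> (L0 + L1 * norm (F x)) * norm (x - y) * exp ?c"
    by (simp add: exp_minus field_simps)
  then show ?thesis
    by (simp add: mult_ac)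
qed

lemma L0_L1_lipschitz_modulus_pos:
  assumes "L0_L1_lipschitz L0 L1 F" "0 < g"
  shows "0 < L0 + L1 * g"
  using assms unfolding L0_L1_lipschitz_def
  by (metis add_nonneg_pos add_pos_nonneg less_eq_real_def mult_nonneg_nonneg mult_pos_pos)

text \<open>
  Here \<open>L\<^sub>1 \<gamma> \<parallel>F(x)\<parallel> \<le> (L\<^sub>0 + L\<^sub>1 \<parallel>F(x)\<parallel>) \<gamma> \<le> \<nu>\<^sub>A\<close>, so that the exponential bound is at most
  \<open>\<nu>\<^sub>A exp \<nu>\<^sub>A \<parallel>F(x)\<parallel>\<close>.
\<close>
lemma critical_condition_L0_L1_lipschitz:
  assumes F: "L0_L1_lipschitz L0 L1 F" and \<nu>A: "\<nu>A * exp \<nu>A \<le> A" and "F x \<noteq> 0" "0 \<le> \<gamma>"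
    and \<gamma>: "\<gamma> \<le> \<nu>A / (L0 + L1 * norm (F x))"
  shows "critical_condition F A x (x - \<gamma> *\<^sub>R F x)"
proof -
  let ?g = "norm (F x)" and ?a = "L0 + L1 * norm (F x)"
  have L: "0 \<le> L0" "0 \<le> L1"
    using F by (auto simp: L0_L1_lipschitz_def)
  have "0 < ?a"
    using L0_L1_lipschitz_modulus_pos[OF F] \<open>F x \<noteq> 0\<close> by simp
  then have a\<gamma>: "?a * \<gamma> \<le> \<nu>A"
    using \<gamma> by (simp add: field_simps)
  have "L1 * (\<gamma> * ?g) \<le> ?a * \<gamma>"
    using L \<open>0 \<le> \<gamma>\<close> by (simp add: algebra_simps)
  with a\<gamma> have "exp (L1 * (\<gamma> * ?g)) \<le> exp \<nu>A"
    by simp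
  moreover have "0 \<le> \<nu>A"
    using a\<gamma> \<open>0 < ?a\<close> \<open>0 \<le> \<gamma>\<close> by (meson less_eq_real_def mult_nonneg_nonneg order_trans)
  ultimately have "?a * \<gamma> * exp (L1 * (\<gamma> * ?g)) \<le> \<nu>A * exp \<nu>A"
    using a\<gamma> by (intro mult_mono) auto
  with \<nu>A have "?a * \<gamma> * exp (L1 * (\<gamma> * ?g)) * ?g \<le> A * ?g"
    by (intro mult_right_mono) auto
  moreover have "norm (F (x - \<gamma> *\<^sub>R F x) - F x) \<le> ?a * exp (L1 * (\<gamma> * ?g)) * (\<gamma> * ?g)"
    using L0_L1_lipschitz_exp_bound[OF F, of "x - \<gamma> *\<^sub>R F x" x] \<open>0 \<le> \<gamma>\<close> by simp
  ultimately show ?thesis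
    by (simp add: critical_condition_def mult_ac)
qed

section \<open>Termination of the line-search\<close>

fun ls_valid :: "ls_state \<Rightarrow> bool" where
  "ls_valid (l0, l1, toggle) \<longleftrightarrow> 0 < l0 \<and> 0 \<le> l1"

lemma ls_gamma_pos:
  assumes "ls_valid s" "0 < \<nu>A" "0 \<le> g"
  shows "0 < ls_gamma \<nu>A g s"
  using assms by (cases s) (auto intro!: divide_pos_pos add_pos_nonneg)

text \<open>
  Each of the two quotients subtracted from \<open>\<beta>\<close> in an update is a share of the denominator
  \<open>\<lambda>\<^sup>0 + \<lambda>\<^sup>1 g\<close>, hence at most 1.
\<close>
lemma ls_update_factors:
  assumes "0 < l0" "0 \<le> l1" "0 \<le> (g :: real)"
  shows "\<beta> - 1 \<le> \<beta> - l0 / (l0 + l1 * g)" "\<beta> - 1 \<le> \<beta> - l1 * g / (l0 + l1 * g)"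
  using assms by (simp_all add: add_pos_nonneg divide_le_eq_1)

lemma ls_valid_update:
  assumes "ls_valid s" "2 < \<beta>" "0 \<le> g"
  shows "ls_valid (ls_update \<beta> g s)"
proof (cases s)
  case (fields l0 l1 toggle)
  with assms have "0 < l0" "0 \<le> l1"
    by auto
  moreover from ls_update_factors[OF this \<open>0 \<le> g\<close>, of \<beta>]
  have "0 < \<beta> - l0 / (l0 + l1 * g)" "0 < \<beta> - l1 * g / (l0 + l1 * g)"
    using \<open>2 < \<beta>\<close> by linarith+
  ultimately show ?thesis
    by (simp add: fields)
qed

lemma ls_valid_update_funpow:
  assumes "ls_valid s" "2 < \<beta>" "0 \<le> g"
  shows "ls_valid ((ls_update \<beta> g ^^ n) s)"
  using assms by (induction n) (simp_all add: ls_valid_update)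

text \<open>
  One of two consecutive updates changes \<open>\<lambda>\<^sup>0\<close>, the other one only \<open>\<lambda>\<^sup>1\<close>. Only \<open>\<lambda>\<^sup>0\<close> can be relied on
  to grow, since \<open>\<lambda>\<^sup>1\<close> stays 0 if it starts at 0.
\<close>
lemma ls_update_twice_fst:
  assumes "ls_valid s" "2 < \<beta>" "0 \<le> g"
  shows "(\<beta> - 1) * fst s \<le> fst (ls_update \<beta> g (ls_update \<beta> g s))"
proof (cases s)
  case (fields l0 l1 toggle)
  have grow: "(\<beta> - 1) * l0 \<le> l0 * (\<beta> - l0 / (l0 + l * g))" if "0 \<le> l" for l
    using ls_update_factors(1)[of l0 l g \<beta>] assms that fields
    by (simp add: mult.commute[of _ l0])
  show ?thesis
  proof (cases "toggle = 0")
    case True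
    then show ?thesis
      using grow[of l1] assms by (simp add: fields)
  next
    case False
    have "0 \<le> l1 * (\<beta> - l1 * g / (l0 + l1 * g))"
      using ls_valid_update[OF assms] False by (simp add: fields)
    from grow[OF this] False show ?thesis
      by (simp add: fields)
  qed
qed

lemma ls_update_even_funpow_fst:
  assumes "ls_valid s" "2 < \<beta>" "0 \<le> g"
  shows "(\<beta> - 1) ^ n * fst s \<le> fst ((ls_update \<beta> g ^^ (2 * n)) s)"
proof (induction n)
  case (Suc n)
  have "(\<beta> - 1) * ((\<beta> - 1) ^ n * fst s) \<le> (\<beta> - 1) * fst ((ls_update \<beta> g ^^ (2 * n)) s)"
    using Suc \<open>2 < \<beta>\<close> by (intro mult_left_mono) auto
  also have "\<dots> \<le> fst ((ls_update \<beta> g ^^ (2 * Suc n)) s)"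
    using ls_update_twice_fst[OF ls_valid_update_funpow[OF assms] assms(2,3)] by simp
  finally show ?case
    by (simp add: mult.assoc)
qed simp

lemma ls_gamma_arbitrarily_small:
  assumes "ls_valid s" "2 < \<beta>" "0 \<le> g" "0 < \<nu>A" "0 < T"
  shows "\<exists>n. ls_gamma \<nu>A g ((ls_update \<beta> g ^^ n) s) \<le> T"
proof -
  have "0 < fst s"
    using assms by (cases s) auto
  obtain n where "\<nu>A / T / fst s < (\<beta> - 1) ^ n"
    using real_arch_pow[of "\<beta> - 1"] \<open>2 < \<beta>\<close> by auto
  then have "\<nu>A / T < (\<beta> - 1) ^ n * fst s"
    by (simp only: pos_divide_less_eq[OF \<open>0 < fst s\<close>])
  also have "\<dots> \<le> fst ((ls_update \<beta> g ^^ (2 * n)) s)"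
    by (rule ls_update_even_funpow_fst[OF assms(1-3)])
  finally have large: "\<nu>A / T < fst ((ls_update \<beta> g ^^ (2 * n)) s)" .
  obtain l0 l1 toggle where s': "(ls_update \<beta> g ^^ (2 * n)) s = (l0, l1, toggle)"
    by (metis prod_cases3)
  have "0 < l0" "0 \<le> l1"
    using ls_valid_update_funpow[OF assms(1-3), of "2 * n"] by (simp_all add: s')
  have "\<nu>A / T < l0"
    using large by (simp add: s')
  also have "l0 \<le> l0 + l1 * g"
    using \<open>0 \<le> l1\<close> \<open>0 \<le> g\<close> by simp
  finally have "\<nu>A / T < l0 + l1 * g" .
  then have "\<nu>A / (l0 + l1 * g) \<le> T"
    using assms \<open>0 < l0\<close> \<open>0 \<le> l1\<close> by (simp add: field_simps add_pos_nonneg)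
  with s' have "ls_gamma \<nu>A g ((ls_update \<beta> g ^^ (2 * n)) s) \<le> T"
    by simp
  then show ?thesis ..
qed

lemma line_search_terminates:
  assumes "ls_valid s" "2 < \<beta>" "0 < \<nu>A" "0 < T"
    and small: "\<And>\<gamma>. 0 < \<gamma> \<Longrightarrow> \<gamma> \<le> T \<Longrightarrow> critical_condition F A x (x - \<gamma> *\<^sub>R F x)"
  shows "\<exists>s'. line_search F A \<nu>A \<beta> x s = Some s'"
proof -
  let ?g = "norm (F x)"
  from ls_gamma_arbitrarily_small[OF assms(1,2) norm_ge_zero assms(3,4)]
  obtain n where n: "ls_gamma \<nu>A ?g ((ls_update \<beta> ?g ^^ n) s) \<le> T"
    by blast
  have "0 < ls_gamma \<nu>A ?g ((ls_update \<beta> ?g ^^ n) s)"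
    using assms by (intro ls_gamma_pos ls_valid_update_funpow) auto
  from small[OF this n]
  have "\<not> norm (F x - F (ls_xhat F \<nu>A x ((ls_update \<beta> ?g ^^ n) s))) > A * ?g"
    by (simp add: critical_condition_def ls_xhat_def norm_minus_commute)
  then show ?thesis
    unfolding line_search_def while_option_def by (metis (mono_tags, lifting))
qed

lemma line_search_valid:
  assumes "line_search F A \<nu>A \<beta> x s = Some s'" "ls_valid s" "2 < \<beta>"
  shows "ls_valid s'"
  using assms unfolding line_search_def
  by (elim while_option_rule[rotated]) (auto intro: ls_valid_update)

lemma line_search_critical_condition:
  assumes "line_search F A \<nu>A \<beta> x s = Some s'"
  shows "critical_condition F A x (ls_xhat F \<nu>A x s')"
  using while_option_stop[OF assms[unfolded line_search_def]]
  by (simp add: critical_condition_def norm_minus_commute)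

section \<open>Iterates and step-sizes of the algorithm\<close>

lemma polyak_eg_ls_valid:
  assumes "polyak_eg_ls F A \<nu>A \<beta> x0 l0 l1 k = Some (x, s)" "0 < l0" "0 \<le> l1" "2 < \<beta>"
  shows "ls_valid s"
  using assms(1)
proof (induction k arbitrary: x s)
  case 0
  then show ?case
    using assms by auto
next
  case (Suc k)
  from Suc.prems obtain x' s' where prev: "polyak_eg_ls F A \<nu>A \<beta> x0 l0 l1 k = Some (x', s')"
    and ls: "line_search F A \<nu>A \<beta> x' s' = Some s"
    by (simp add: Let_def split: option.split_asm prod.split_asm if_split_asm)
  from ls Suc.IH[OF prev] \<open>2 < \<beta>\<close> show ?case
    by (rule line_search_valid)
qed

lemma polyak_eg_ls_stepsize_exists:
  assumes it: "polyak_eg_ls_iterate F A \<nu>A \<beta> x0 l0 l1 k = Some x" and "F x \<noteq> 0"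
    and pars: "0 < l0" "0 \<le> l1" "2 < \<beta>" "0 < \<nu>A" and "0 < T"
    and small: "\<And>\<gamma>. 0 < \<gamma> \<Longrightarrow> \<gamma> \<le> T \<Longrightarrow> critical_condition F A x (x - \<gamma> *\<^sub>R F x)"
  shows "\<exists>g>0. polyak_eg_ls_stepsize F A \<nu>A \<beta> x0 l0 l1 k = Some g"
proof -
  from it obtain s where s: "polyak_eg_ls F A \<nu>A \<beta> x0 l0 l1 k = Some (x, s)"
    by (auto simp: polyak_eg_ls_iterate_def)
  have "ls_valid s"
    using polyak_eg_ls_valid[OF s] pars by simp
  then obtain s' where s': "line_search F A \<nu>A \<beta> x s = Some s'"
    using line_search_terminates[OF _ _ _ \<open>0 < T\<close> small] pars by blast
  then have "ls_valid s'"
    using line_search_valid \<open>ls_valid s\<close> pars by blast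
  then have "0 < ls_gamma \<nu>A (norm (F x)) s'"
    using pars by (simp add: ls_gamma_pos)
  then show ?thesis
    using s s' \<open>F x \<noteq> 0\<close> by (simp add: polyak_eg_ls_stepsize_def)
qed

lemma polyak_eg_ls_stepsize_critical_condition:
  assumes "polyak_eg_ls_iterate F A \<nu>A \<beta> x0 l0 l1 k = Some x"
    and "polyak_eg_ls_stepsize F A \<nu>A \<beta> x0 l0 l1 k = Some \<gamma>"
  shows "critical_condition F A x (x - \<gamma> *\<^sub>R F x)"
proof -
  from assms obtain s s' where "line_search F A \<nu>A \<beta> x s = Some s'"
    and "\<gamma> = ls_gamma \<nu>A (norm (F x)) s'"
    by (auto simp: polyak_eg_ls_iterate_def polyak_eg_ls_stepsize_def split: if_split_asm)
  then show ?thesis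
    using line_search_critical_condition by (fastforce simp: ls_xhat_def)
qed

theorem proposition3p3:
  fixes F :: "real ^ 'd \<Rightarrow> real ^ 'd" and A \<gamma> :: real and x xhat :: "real ^ 'd"
  assumes "0 < A" and "A \<le> 1" and "F x \<noteq> 0" and "0 < \<gamma>"
    and "xhat = x - \<gamma> *\<^sub>R F x"
  shows
    "(\<forall>L. 0 < L \<and> L-lipschitz_on UNIV F \<and> \<gamma> \<le> A / L
        \<longrightarrow> critical_condition F A x xhat) \<and>
     (\<forall>L \<nu>. 0 < L \<and> 0 < \<nu> \<and> \<nu> \<le> 1 \<and> holder_continuous L \<nu> F \<and>
        \<gamma> \<le> (A / L) powr (1 / \<nu>) * norm (F x) powr ((1 - \<nu>) / \<nu>)
        \<longrightarrow> critical_condition F A x xhat) \<and>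
     (\<forall>L0 L1 \<nu>A. L0_L1_lipschitz L0 L1 F \<and> 0 < \<nu>A \<and> \<nu>A * exp \<nu>A \<le> A \<and>
        \<gamma> \<le> \<nu>A / (L0 + L1 * norm (F x))
        \<longrightarrow> critical_condition F A x xhat) \<and>
     (\<forall>x0 l0 l1 \<beta> \<nu>A k.
        ((\<exists>L. 0 < L \<and> L-lipschitz_on UNIV F) \<or>
         (\<exists>L \<nu>. 0 < L \<and> 0 < \<nu> \<and> \<nu> \<le> 1 \<and> holder_continuous L \<nu> F) \<or>
         (\<exists>L0 L1. L0_L1_lipschitz L0 L1 F)) \<and>
        0 < l0 \<and> 0 \<le> l1 \<and> 2 < \<beta> \<and> 0 < \<nu>A \<and> \<nu>A * exp \<nu>A \<le> A \<and>
        polyak_eg_ls_iterate F A \<nu>A \<beta> x0 l0 l1 k = Some x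
        \<longrightarrow> (\<exists>g>0. polyak_eg_ls_stepsize F A \<nu>A \<beta> x0 l0 l1 k = Some g) \<and>
            (polyak_eg_ls_stepsize F A \<nu>A \<beta> x0 l0 l1 k = Some \<gamma>
              \<longrightarrow> critical_condition F A x xhat))"
proof -
  have threshold: "\<exists>T>0. \<forall>\<gamma>. 0 < \<gamma> \<longrightarrow> \<gamma> \<le> T \<longrightarrow> critical_condition F A x (x - \<gamma> *\<^sub>R F x)"
    if "(\<exists>L. 0 < L \<and> L-lipschitz_on UNIV F) \<or>
        (\<exists>L \<nu>. 0 < L \<and> 0 < \<nu> \<and> \<nu> \<le> 1 \<and> holder_continuous L \<nu> F) \<or>
        (\<exists>L0 L1. L0_L1_lipschitz L0 L1 F)"
      and \<nu>A: "0 < \<nu>A" "\<nu>A * exp \<nu>A \<le> A" for \<nu>A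
    using that(1)
  proof (elim disjE exE conjE)
    fix L assume "0 < L" "L-lipschitz_on UNIV F"
    with \<open>0 < A\<close> show ?thesis
      by (intro exI[of _ "A / L"] conjI allI impI critical_condition_lipschitz) auto
  next
    fix L \<nu> assume "0 < L" "0 < \<nu>" "holder_continuous L \<nu> F"
    with \<open>0 < A\<close> \<open>F x \<noteq> 0\<close> show ?thesis
      by (intro exI[of _ "(A / L) powr (1 / \<nu>) * norm (F x) powr ((1 - \<nu>) / \<nu>)"] conjI allI impI
          critical_condition_holder[of A L \<nu>]) auto
  next
    fix L0 L1 assume "L0_L1_lipschitz L0 L1 F"
    moreover from this have "0 < \<nu>A / (L0 + L1 * norm (F x))"
      using \<nu>A \<open>F x \<noteq> 0\<close> by (simp add: L0_L1_lipschitz_modulus_pos)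
    ultimately show ?thesis
      using \<nu>A \<open>F x \<noteq> 0\<close>
      by (intro exI[of _ "\<nu>A / (L0 + L1 * norm (F x))"] conjI allI impI
          critical_condition_L0_L1_lipschitz[of L0 L1 F \<nu>A]) auto
  qed
  show ?thesis
    unfolding \<open>xhat = x - \<gamma> *\<^sub>R F x\<close>
  proof (intro conjI allI impI; elim conjE)
    fix L assume "0 < L" "L-lipschitz_on UNIV F" "\<gamma> \<le> A / L"
    with \<open>0 < \<gamma>\<close> show "critical_condition F A x (x - \<gamma> *\<^sub>R F x)"
      by (simp add: critical_condition_lipschitz)
  next
    fix L \<nu> assume "0 < L" "0 < \<nu>" "holder_continuous L \<nu> F"
      "\<gamma> \<le> (A / L) powr (1 / \<nu>) * norm (F x) powr ((1 - \<nu>) / \<nu>)"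
    with \<open>0 < A\<close> \<open>F x \<noteq> 0\<close> \<open>0 < \<gamma>\<close> show "critical_condition F A x (x - \<gamma> *\<^sub>R F x)"
      by (simp add: critical_condition_holder)
  next
    fix L0 L1 \<nu>A assume "L0_L1_lipschitz L0 L1 F" "\<nu>A * exp \<nu>A \<le> A"
      "\<gamma> \<le> \<nu>A / (L0 + L1 * norm (F x))"
    with \<open>F x \<noteq> 0\<close> \<open>0 < \<gamma>\<close> show "critical_condition F A x (x - \<gamma> *\<^sub>R F x)"
      by (simp add: critical_condition_L0_L1_lipschitz)
  next
    fix x0 l0 l1 \<beta> \<nu>A k
    assume F: "(\<exists>L. 0 < L \<and> L-lipschitz_on UNIV F) \<or>
        (\<exists>L \<nu>. 0 < L \<and> 0 < \<nu> \<and> \<nu> \<le> 1 \<and> holder_continuous L \<nu> F) \<or>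
        (\<exists>L0 L1. L0_L1_lipschitz L0 L1 F)"
      and pars: "0 < l0" "0 \<le> l1" "2 < \<beta>" "0 < \<nu>A" and \<nu>A: "\<nu>A * exp \<nu>A \<le> A"
      and it: "polyak_eg_ls_iterate F A \<nu>A \<beta> x0 l0 l1 k = Some x"
    obtain T where "0 < T"
      "\<And>\<gamma>. 0 < \<gamma> \<Longrightarrow> \<gamma> \<le> T \<Longrightarrow> critical_condition F A x (x - \<gamma> *\<^sub>R F x)"
      using threshold[OF F \<open>0 < \<nu>A\<close> \<nu>A] by blast
    then show "\<exists>g>0. polyak_eg_ls_stepsize F A \<nu>A \<beta> x0 l0 l1 k = Some g"
      by (rule polyak_eg_ls_stepsize_exists[OF it \<open>F x \<noteq> 0\<close> pars])
  next
    fix x0 l0 l1 \<beta> \<nu>A k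
    assume "polyak_eg_ls_iterate F A \<nu>A \<beta> x0 l0 l1 k = Some x"
      "polyak_eg_ls_stepsize F A \<nu>A \<beta> x0 l0 l1 k = Some \<gamma>"
    then show "critical_condition F A x (x - \<gamma> *\<^sub>R F x)"
      by (rule polyak_eg_ls_stepsize_critical_condition)
  qed
qed

end
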